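(* Let $G$ be a cubic quadrangulation. If $G$ has an odd number of vertices, then $\epsilon(R(G))$ is not connected. Furthermore, if $\epsilon(R(G))$ is connected, then the induced embedding of $R(G)$ contains at least one transversal.
   Context: A cubic quadrangulation is a cellular embedding of a (multi)graph in the sphere $S^2$ in which every vertex has degree 3 or 4 and every face is a quadrangle (boundary walk of length 4). The radial graph $R(G)$ has vertex set $V(G)\cup F(G)$ ($F(G)$ the faces) and an edge $vf$ for each occurrence of vertex $v$ on the boundary of face $f$; it inherits an embedding in $S^2$, which is again a cubic quadrangulation (face-vertices have degree 4). A transverse path is a walk $v_0,\dots,v_k$ whose internal vertices have degree 4 and at each internal vertex the two edges of the walk are non-consecutive in the rotation at that vertex; it is complete if its endpoints have degree 3. The extraction $\epsilon(H)$ of a cubic quadrangulation $H$ is the multigraph whose vertices are the degree-3 vertices of $H$, with one edge joining the endpoints of each complete transverse path. A transversal (transverse closed walk) is a closed walk all of whose vertices have degree 4 such that at each vertex consecutive edges of the walk are non-consecutive in the rotation. *)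

theory Defs
  imports "Graph_Theory.Graph_Theory" "HOL-Combinatorics.Orbits"
begin

text \<open>
  A multigraph is represented by its arcs (half-edges): every edge, loops included, consists of
  two mutually opposite arcs \<open>e\<close> and \<open>opp M e\<close>.  Hence the degree of a vertex (loops counting
  twice) is the number of arcs leaving it.
\<close>

record ('v, 'e) multigraph =
  dgr :: "('v, 'e) pre_digraph"
  opp :: "'e \<Rightarrow> 'e"

abbreviation vertices :: "('v, 'e, 'x) multigraph_scheme \<Rightarrow> 'v set" where
  "vertices M \<equiv> verts (dgr M)"

abbreviation degree :: "('v, 'e, 'x) multigraph_scheme \<Rightarrow> 'v \<Rightarrow> nat" where
  "degree M v \<equiv> out_degree (dgr M) v"

definition edges :: "('v, 'e, 'x) multigraph_scheme \<Rightarrow> 'e set set" where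
  "edges M = {{e, opp M e} | e. e \<in> arcs (dgr M)}"

definition is_multigraph :: "('v, 'e, 'x) multigraph_scheme \<Rightarrow> bool" where
  "is_multigraph M \<longleftrightarrow> fin_digraph (dgr M) \<and> bidirected_digraph (dgr M) (opp M)"

abbreviation connected_multigraph :: "('v, 'e, 'x) multigraph_scheme \<Rightarrow> bool" where
  "connected_multigraph M \<equiv> Digraph_Component.connected (dgr M)"

text \<open>
  Cellular embeddings in an oriented closed surface are given by rotation systems: \<open>rot G\<close>
  maps an arc to the next arc, counterclockwise, with the same tail.
\<close>

record ('v, 'e) embedded_multigraph = "('v, 'e) multigraph" +
  rot :: "'e \<Rightarrow> 'e"

definition is_embedding :: "('v, 'e) embedded_multigraph \<Rightarrow> bool" where
  "is_embedding G \<longleftrightarrow> is_multigraph G \<and> rot G permutes arcs (dgr G) \<and>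
     (\<forall>v \<in> vertices G. out_arcs (dgr G) v \<noteq> {} \<longrightarrow> cyclic_on (rot G) (out_arcs (dgr G) v))"

text \<open>
  The face to the left of an arc \<open>e\<close> is traced by turning, at the head of \<open>e\<close>, into the arc
  clockwise next to \<open>opp G e\<close>.  A face is identified with the set of arcs having it on their left;
  these are the successive steps of its boundary walk, so its cardinality is the length of that
  walk (an edge with the same face on both sides contributes two arcs).
\<close>

definition face_step :: "('v, 'e) embedded_multigraph \<Rightarrow> 'e \<Rightarrow> 'e" where
  "face_step G e = inv (rot G) (opp G e)"

definition face_of :: "('v, 'e) embedded_multigraph \<Rightarrow> 'e \<Rightarrow> 'e set" where
  "face_of G e = orbit (face_step G) e"

definition faces :: "('v, 'e) embedded_multigraph \<Rightarrow> 'e set set" where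
  "faces G = face_of G ` arcs (dgr G)"

text \<open>The surface is the sphere iff the graph is connected and the Euler characteristic is 2.\<close>

definition spherical_embedding :: "('v, 'e) embedded_multigraph \<Rightarrow> bool" where
  "spherical_embedding G \<longleftrightarrow> is_embedding G \<and> connected_multigraph G \<and>
     int (card (vertices G)) - int (card (edges G)) + int (card (faces G)) = 2"

definition cubic_quadrangulation :: "('v, 'e) embedded_multigraph \<Rightarrow> bool" where
  "cubic_quadrangulation G \<longleftrightarrow> spherical_embedding G \<and>
     (\<forall>v \<in> vertices G. degree G v = 3 \<or> degree G v = 4) \<and>
     (\<forall>f \<in> faces G. card f = 4)"

text \<open>
  The occurrences of vertices on face boundaries are the corners of the embedding.  The corner
  between \<open>e\<close> and \<open>rot G e\<close>, which joins \<open>tail e\<close> to the face on the left of \<open>e\<close>, is named by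
  \<open>e\<close>; the corresponding edge of the radial graph consists of the arc \<open>(e, False)\<close> from the vertex
  to the face and its opposite \<open>(e, True)\<close>.  Counterclockwise around a vertex the corners follow
  each other by \<open>rot G\<close>; counterclockwise around (the centre of) a face, they follow its
  boundary walk, i.e. \<open>face_step G\<close>.
\<close>

definition radial_graph ::
  "('v, 'e) embedded_multigraph \<Rightarrow> ('v + 'e set, 'e \<times> bool) embedded_multigraph" where
  "radial_graph G = \<lparr>
     dgr = \<lparr> verts = Inl ` vertices G \<union> Inr ` faces G,
             arcs = arcs (dgr G) \<times> UNIV,
             tail = (\<lambda>(e, b). if b then Inr (face_of G e) else Inl (tail (dgr G) e)),
             head = (\<lambda>(e, b). if b then Inl (tail (dgr G) e) else Inr (face_of G e)) \<rparr>,
     opp = (\<lambda>(e, b). if e \<in> arcs (dgr G) then (e, \<not> b) else (e, b)),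
     rot = (\<lambda>(e, b). if b then (face_step G e, b) else (rot G e, b)) \<rparr>"

text \<open>
  A walk arriving by the arc \<open>e\<close> at a vertex of degree 4 and leaving by the arc \<open>e'\<close>: the two
  half-edges at that vertex are \<open>opp H e\<close> and \<open>e'\<close>, and they have to be distinct and
  non-consecutive in the rotation.
\<close>

definition passes_transversely :: "('v, 'e) embedded_multigraph \<Rightarrow> 'e \<Rightarrow> 'e \<Rightarrow> bool" where
  "passes_transversely H e e' \<longleftrightarrow>
     head (dgr H) e = tail (dgr H) e' \<and> degree H (tail (dgr H) e') = 4 \<and>
     e' \<noteq> opp H e \<and> e' \<noteq> rot H (opp H e) \<and> opp H e \<noteq> rot H e'"

definition transverse_path :: "('v, 'e) embedded_multigraph \<Rightarrow> 'v \<Rightarrow> 'e list \<Rightarrow> 'v \<Rightarrow> bool" where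
  "transverse_path H u p v \<longleftrightarrow> pre_digraph.awalk (dgr H) u p v \<and>
     (\<forall>i. Suc i < length p \<longrightarrow> passes_transversely H (p ! i) (p ! Suc i))"

definition complete_transverse_path ::
  "('v, 'e) embedded_multigraph \<Rightarrow> 'v \<Rightarrow> 'e list \<Rightarrow> 'v \<Rightarrow> bool" where
  "complete_transverse_path H u p v \<longleftrightarrow>
     transverse_path H u p v \<and> p \<noteq> [] \<and> degree H u = 3 \<and> degree H v = 3"

text \<open>
  The arcs of the extraction are the complete transverse paths with a direction of traversal, and
  the opposite of an arc is the same path traversed backwards.  Thus there is one edge for each
  complete transverse path, where a path and its reverse are not distinguished.
\<close>

definition extraction :: "('v, 'e) embedded_multigraph \<Rightarrow> ('v, 'e list) multigraph" where
  "extraction H = (let P = {p. \<exists>u v. complete_transverse_path H u p v} in \<lparr>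
     dgr = \<lparr> verts = {v \<in> vertices H. degree H v = 3},
             arcs = P,
             tail = (\<lambda>p. tail (dgr H) (hd p)),
             head = (\<lambda>p. head (dgr H) (last p)) \<rparr>,
     opp = (\<lambda>p. if p \<in> P then rev (map (opp H) p) else p) \<rparr>)"

definition transversal :: "('v, 'e) embedded_multigraph \<Rightarrow> 'e list \<Rightarrow> bool" where
  "transversal H p \<longleftrightarrow> p \<noteq> [] \<and>
     (\<exists>u. pre_digraph.awalk (dgr H) u p u \<and>
          (\<forall>v \<in> set (pre_digraph.awalk_verts (dgr H) u p). degree H v = 4)) \<and>
     (\<forall>i < length p. passes_transversely H (p ! i) (p ! (Suc i mod length p)))"

end

theory Submission
  imports Defs
begin

text \<open>
  A spherical quadrangulation \<open>G\<close> is bipartite.  A transverse path of \<open>R(G)\<close> crosses each face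
  of \<open>G\<close> that it visits from a vertex to the opposite one, hence stays in one colour class of
  \<open>G\<close>; so if \<open>\<epsilon>(R(G))\<close> is connected, all vertices of degree 3 lie in the same class.  The
  other class then has only vertices of degree 4: counting the edges at it shows that the number of
  vertices is even, and a transverse walk started at it never meets a vertex of degree 3,
  so it closes up to a transversal.
\<close>

section \<open>Cochains with coefficients in the field of two elements\<close>

lemma connected_invariant:
  assumes con: "Digraph_Component.connected D"
    and inv: "\<And>a. a \<in> arcs D \<Longrightarrow> P (tail D a) \<longleftrightarrow> P (head D a)"
    and uv: "u \<in> verts D" "v \<in> verts D"
  shows "P u \<longleftrightarrow> P v"
proof -
  have "(u, v) \<in> rtrancl_on (verts D) (parcs (mk_symmetric D))"
    using con uv unfolding connected_def strongly_connected_def reachable_def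
    by (auto simp: mk_symmetric_def)
  then show ?thesis
    by induction (use inv in \<open>auto simp: mk_symmetric_def\<close>)
qed

text \<open>Rank-nullity over the field of two elements, stated with cardinalities:
  \<open>Pow E\<close> is a group under symmetric difference, and all nonempty fibres of
  \<open>f\<close> are cosets of its kernel.\<close>

lemma card_Pow_sym_diff_hom:
  assumes "finite E"
    and hom: "\<And>X Y. X \<subseteq> E \<Longrightarrow> Y \<subseteq> E \<Longrightarrow> f (sym_diff X Y) = sym_diff (f X) (f Y)"
  shows "2 ^ card E = card {X. X \<subseteq> E \<and> f X = {}} * card (f ` Pow E)"
proof -
  have fib: "card {X. X \<in> Pow E \<and> f X = y} = card {X. X \<subseteq> E \<and> f X = {}}" if y: "y \<in> f ` Pow E" for y
  proof -
    obtain Z where Z: "Z \<subseteq> E" "y = f Z" using y by auto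
    \<comment> \<open>Translation by \<open>Z\<close> is its own inverse and exchanges the kernel
      with the fibre over \<open>f Z\<close>.\<close>
    have "bij_betw (sym_diff Z) {X. X \<subseteq> E \<and> f X = {}} {X. X \<in> Pow E \<and> f X = y}"
    proof (rule bij_betwI[where g = "sym_diff Z"])
      show "sym_diff Z \<in> {X. X \<subseteq> E \<and> f X = {}} \<rightarrow> {X. X \<in> Pow E \<and> f X = y}"
        using Z hom[OF Z(1)] by auto
      show "sym_diff Z \<in> {X. X \<in> Pow E \<and> f X = y} \<rightarrow> {X. X \<subseteq> E \<and> f X = {}}"
        using Z hom[OF Z(1)] by auto
    qed auto
    then show ?thesis by (simp add: bij_betw_same_card)
  qed
  have "2 ^ card E = (\<Sum>X\<in>Pow E. 1 :: nat)" using assms(1) by (simp add: card_Pow)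
  also have "\<dots> = (\<Sum>y\<in>f ` Pow E. \<Sum>X | X \<in> Pow E \<and> f X = y. 1)"
    using assms(1) by (intro sum.image_gen) simp
  also have "\<dots> = (\<Sum>y\<in>f ` Pow E. card {X. X \<subseteq> E \<and> f X = {}})"
    using fib by (intro sum.cong) auto
  finally show ?thesis by (simp add: mult.commute)
qed

lemma card_sym_diff_parity:
  assumes "finite A" "finite B"
  shows "odd (card (sym_diff A B)) \<longleftrightarrow> odd (card A) \<noteq> odd (card B)"
proof -
  have "card (sym_diff A B) = card (A - B) + card (B - A)"
    using assms by (intro card_Un_disjoint) auto
  moreover have "card A = card (A - B) + card (A \<inter> B)" "card B = card (B - A) + card (A \<inter> B)"
    using assms card_Diff_subset_Int[of A B] card_Diff_subset_Int[of B A] card_mono[of A "A \<inter> B"] card_mono[of B "A \<inter> B"]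
    by (auto simp: Int_commute)
  ultimately show ?thesis by presburger
qed

text \<open>\<open>P\<close> and its composite with \<open>s\<close> hold equally often on
  \<open>A\<close>, and the symmetric difference of two finite sets of equal size is even. Applied
  to the boundary walk of a face.\<close>

lemma even_changes_of_bij:
  fixes P :: "'a \<Rightarrow> bool"
  assumes "finite A" "bij_betw s A A"
  shows "even (card {x \<in> A. P x \<noteq> P (s x)})"
proof -
  have "bij_betw s {x \<in> A. P (s x)} {x \<in> A. P x}"
    using assms(2) unfolding bij_betw_def by (auto intro: inj_on_subset)
  then have "card {x \<in> A. P (s x)} = card {x \<in> A. P x}" by (rule bij_betw_same_card)
  moreover have "{x \<in> A. P x \<noteq> P (s x)} = sym_diff {x \<in> A. P x} {x \<in> A. P (s x)}" by auto
  ultimately show ?thesis using card_sym_diff_parity[of "{x \<in> A. P x}" "{x \<in> A. P (s x)}"] assms(1) by simp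
qed

text \<open>Spells out a rotation of order four, so that "non-consecutive" can be checked case by
  case to mean "two steps away".\<close>

lemma cyclic_on_card_4:
  assumes cyc: "cyclic_on f S" and "card S = 4" and "x \<in> S"
  shows "S = {x, f x, f (f x), f (f (f x))}" "f (f (f (f x))) = x"
    "f x \<noteq> x" "f (f x) \<noteq> x" "f (f (f x)) \<noteq> x"
proof -
  have orb: "S = orbit f x" using orbit_cyclic_eq3[OF cyc \<open>x \<in> S\<close>] by simp
  \<comment> \<open>The first positive return time of \<open>x\<close>, hence the size of its
    orbit.\<close>
  define n where "n = funpow_dist1 f x x"
  have self: "x \<in> orbit f x" using orb \<open>x \<in> S\<close> by simp
  have "S = (\<lambda>n. (f ^^ n) x) ` {0..<n}"
    using orbit_conv_funpow_dist1[OF self] orb n_def by simp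
  moreover have inj: "inj_on (\<lambda>n. (f ^^ n) x) {0..<n}"
    using inj_on_funpow_dist1[OF self] n_def by simp
  ultimately have n4: "n = 4" using \<open>card S = 4\<close> by (simp add: card_image)
  have 4: "{0..<4} = {0, 1, 2, 3::nat}" by auto
  show "S = {x, f x, f (f x), f (f (f x))}"
    using \<open>S = _ ` _\<close> unfolding n4 4 by (simp add: eval_nat_numeral)
  show "f (f (f (f x))) = x"
    using funpow_dist1_prop[OF self] unfolding n_def[symmetric] n4 by (simp add: eval_nat_numeral)
  show "f x \<noteq> x" "f (f x) \<noteq> x" "f (f (f x)) \<noteq> x"
    using inj unfolding n4 4 by (auto simp: eval_nat_numeral)
qed

section \<open>Rotation systems: arcs around vertices and faces, and counts of arcs\<close>

locale embedding =
  fixes G :: "('v, 'e) embedded_multigraph"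
  assumes embedding: "is_embedding G"
begin

sublocale fin_digraph "dgr G"
  using embedding by (simp add: is_embedding_def is_multigraph_def)

sublocale bidirected_digraph "dgr G" "opp G"
  using embedding by (simp add: is_embedding_def is_multigraph_def)

lemma rot_permutes: "rot G permutes arcs (dgr G)"
  using embedding by (simp add: is_embedding_def)

lemma rot_in_arcs [simp]: "rot G e \<in> arcs (dgr G) \<longleftrightarrow> e \<in> arcs (dgr G)"
  using permutes_in_image[OF rot_permutes] .

lemma rot_cyclic:
  assumes "e \<in> arcs (dgr G)"
  shows "cyclic_on (rot G) (out_arcs (dgr G) (tail (dgr G) e))"
proof -
  have "e \<in> out_arcs (dgr G) (tail (dgr G) e)" using assms by simp
  then have "out_arcs (dgr G) (tail (dgr G) e) \<noteq> {}" by blast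
  then show ?thesis using embedding assms by (simp add: is_embedding_def)
qed

lemma tail_rot [simp]: "e \<in> arcs (dgr G) \<Longrightarrow> tail (dgr G) (rot G e) = tail (dgr G) e"
  using cyclic_on_inI[OF rot_cyclic, of e e] by simp

lemma face_step_permutes: "face_step G permutes arcs (dgr G)"
proof -
  have "face_step G = inv (rot G) \<circ> opp G" by (simp add: fun_eq_iff face_step_def)
  then show ?thesis
    using permutes_compose[OF arev_permutes_arcs permutes_inv[OF rot_permutes]] by simp
qed

lemma face_step_in_arcs [simp]: "face_step G e \<in> arcs (dgr G) \<longleftrightarrow> e \<in> arcs (dgr G)"
  using permutes_in_image[OF face_step_permutes] .

lemma rot_face_step: "rot G (face_step G e) = opp G e"
  by (simp add: face_step_def permutes_inverses(1)[OF rot_permutes])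

lemma tail_face_step [simp]:
  assumes "e \<in> arcs (dgr G)"
  shows "tail (dgr G) (face_step G e) = head (dgr G) e"
  using tail_rot[of "face_step G e"] assms by (simp add: rot_face_step)

lemma face_cyclic: "cyclic_on (face_step G) (face_of G e)"
  unfolding face_of_def using face_step_permutes finite_arcs by (rule cyclic_on_orbit)

text \<open>\<open>orbit\<close> collects only iterates with positive exponent; the arc itself is
  reached because a permutation of a finite set returns to its start.\<close>

lemma face_of_self [simp]: "e \<in> face_of G e"
  unfolding face_of_def using face_step_permutes finite_arcs permutation_permutes
  by (intro permutation_self_in_orbit) blast

lemma face_of_eq: "x \<in> face_of G e \<Longrightarrow> face_of G x = face_of G e"
  using orbit_cyclic_eq3[OF face_cyclic] by (simp add: face_of_def)

lemma face_of_face_step [simp]: "face_of G (face_step G e) = face_of G e"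
  by (intro face_of_eq cyclic_on_inI[OF face_cyclic]) simp

lemma face_of_subset: "e \<in> arcs (dgr G) \<Longrightarrow> face_of G e \<subseteq> arcs (dgr G)"
  unfolding face_of_def using face_step_permutes by (rule permutes_orbit_subset)

lemma faces_subset: "f \<in> faces G \<Longrightarrow> f \<subseteq> arcs (dgr G)"
  unfolding faces_def using face_of_subset by auto

lemma faceI [simp]: "e \<in> arcs (dgr G) \<Longrightarrow> face_of G e \<in> faces G"
  by (simp add: faces_def)

lemma face_eq_iff: "f \<in> faces G \<Longrightarrow> e \<in> f \<longleftrightarrow> face_of G e = f"
  unfolding faces_def using face_of_eq face_of_self by blast

lemma finite_face: "f \<in> faces G \<Longrightarrow> finite f"
  using faces_subset finite_arcs by (meson finite_subset)

lemma finite_faces: "finite (faces G)"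
  by (simp add: faces_def)

lemma edges_eq_image: "edges G = (\<lambda>e. {e, opp G e}) ` arcs (dgr G)"
  by (auto simp: edges_def)

lemma finite_edges: "finite (edges G)"
  by (simp add: edges_eq_image)

lemma card_arcs_faces: "card (arcs (dgr G)) = (\<Sum>f\<in>faces G. card f)"
proof -
  have "card (\<Union> (faces G)) = (\<Sum>f\<in>faces G. card f)"
  proof (rule card_Union_disjoint)
    show "pairwise disjnt (faces G)"
      unfolding pairwise_def disjnt_def using face_eq_iff by blast
  qed (rule finite_face)
  moreover have "\<Union> (faces G) = arcs (dgr G)"
    using faces_subset by (auto simp: faces_def intro: face_of_self)
  ultimately show ?thesis by simp
qed

text \<open>\<open>opp G\<close> is an involution without fixed arcs, so even a loop contributes two
  arcs.\<close>

lemma card_arcs_edges: "card (arcs (dgr G)) = 2 * card (edges G)"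
proof -
  have "card (\<Union> (edges G)) = (\<Sum>x\<in>edges G. card x)"
  proof (rule card_Union_disjoint)
    show "pairwise disjnt (edges G)"
      unfolding pairwise_def disjnt_def edges_def by (auto simp: arev_eq_iff)
  qed (auto simp: edges_def)
  moreover have "\<Union> (edges G) = arcs (dgr G)"
    by (auto simp: edges_def)
  moreover have "card x = 2" if "x \<in> edges G" for x
    using that by (auto simp: edges_def card_insert_if dest: arev_neq)
  ultimately show ?thesis by simp
qed

lemma card_arcs_degrees:
  assumes "S \<subseteq> vertices G"
  shows "card {e \<in> arcs (dgr G). tail (dgr G) e \<in> S} = (\<Sum>v\<in>S. degree G v)"
proof -
  have fin: "finite S" using assms finite_verts by (rule finite_subset)
  have "{e \<in> arcs (dgr G). tail (dgr G) e \<in> S} = (\<Union>v\<in>S. out_arcs (dgr G) v)" by auto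
  moreover have "card (\<Union>v\<in>S. out_arcs (dgr G) v) = (\<Sum>v\<in>S. card (out_arcs (dgr G) v))"
    by (rule card_UN_disjoint[OF fin]) auto
  ultimately show ?thesis by (simp add: out_degree_def)
qed

section \<open>Coboundary maps modulo two and bounds for their ranks\<close>

definition cut :: "'v set \<Rightarrow> 'e set set" where
  "cut S = {x \<in> edges G. \<exists>e\<in>x. tail (dgr G) e \<in> S \<and> head (dgr G) e \<notin> S}"

text \<open>With sets as cochains modulo two, \<open>cut\<close> is the coboundary from vertices to
  edges and \<open>odd_faces\<close> the one from edges to faces. Arcs are counted, so an edge with
  the same face on both sides counts twice and cancels.\<close>

definition odd_faces :: "'e set set \<Rightarrow> 'e set set" where
  "odd_faces X = {f \<in> faces G. odd (card {e \<in> f. {e, opp G e} \<in> X})}"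

lemma edge_in_cut:
  assumes "e \<in> arcs (dgr G)"
  shows "{e, opp G e} \<in> cut S \<longleftrightarrow> (tail (dgr G) e \<in> S) \<noteq> (head (dgr G) e \<in> S)"
  using assms by (auto simp: cut_def edges_def)

lemma cut_subset: "cut S \<subseteq> edges G"
  by (auto simp: cut_def)

lemma edge_sets_eqI:
  assumes "X \<subseteq> edges G" "Y \<subseteq> edges G"
    and "\<And>e. e \<in> arcs (dgr G) \<Longrightarrow> {e, opp G e} \<in> X \<longleftrightarrow> {e, opp G e} \<in> Y"
  shows "X = Y"
  using assms unfolding edges_def by blast

lemma cut_sym_diff: "cut (sym_diff S T) = sym_diff (cut S) (cut T)"
  using cut_subset by (intro edge_sets_eqI) (auto simp: edge_in_cut)

lemma odd_faces_sym_diff: "odd_faces (sym_diff X Y) = sym_diff (odd_faces X) (odd_faces Y)"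
proof -
  have "odd (card {e \<in> f. {e, opp G e} \<in> sym_diff X Y}) \<longleftrightarrow>
      odd (card {e \<in> f. {e, opp G e} \<in> X}) \<noteq> odd (card {e \<in> f. {e, opp G e} \<in> Y})"
    if "f \<in> faces G" for f
  proof -
    have "{e \<in> f. {e, opp G e} \<in> sym_diff X Y} =
        sym_diff {e \<in> f. {e, opp G e} \<in> X} {e \<in> f. {e, opp G e} \<in> Y}" by blast
    then show ?thesis
      using finite_face[OF that] by (simp only:) (intro card_sym_diff_parity; simp)
  qed
  then show ?thesis unfolding odd_faces_def by blast
qed

text \<open>The coboundary of a coboundary vanishes: a closed boundary walk enters and leaves
  \<open>S\<close> equally often.\<close>

lemma odd_faces_cut: "odd_faces (cut S) = {}"
proof -
  have "even (card {e \<in> f. {e, opp G e} \<in> cut S})" if f: "f \<in> faces G" for f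
  proof -
    \<comment> \<open>The head of \<open>e\<close> is the tail of the next arc of the boundary walk,
      so cut edges are changes of side between successive arcs.\<close>
    have "{e \<in> f. {e, opp G e} \<in> cut S} =
        {e \<in> f. (tail (dgr G) e \<in> S) \<noteq> (tail (dgr G) (face_step G e) \<in> S)}"
      using faces_subset[OF f] by (auto simp: edge_in_cut)
    moreover have "bij_betw (face_step G) f f"
    proof -
      have "face_step G ` f \<subseteq> f" using f face_eq_iff by auto
      moreover have "inj_on (face_step G) f"
        using permutes_inj[OF face_step_permutes] by (rule inj_on_subset) simp
      ultimately show ?thesis
        using finite_face[OF f] by (simp add: bij_betw_def endo_inj_surj)
    qed
    ultimately show ?thesis
      using even_changes_of_bij[OF finite_face[OF f]] by simp
  qed
  then show ?thesis by (auto simp: odd_faces_def)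
qed

text \<open>This is the dual edge, joining the faces on the two sides of \<open>e\<close>; if they
  coincide, both sides of the equation are empty.\<close>

lemma odd_faces_single_edge:
  assumes "e \<in> arcs (dgr G)"
  shows "odd_faces {{e, opp G e}} = sym_diff {face_of G e} {face_of G (opp G e)}"
proof -
  have "{x \<in> f. {x, opp G x} \<in> {{e, opp G e}}} = f \<inter> {e, opp G e}" for f
    by (auto simp: doubleton_eq_iff)
  then have "odd_faces {{e, opp G e}} = {f \<in> faces G. odd (card (f \<inter> {e, opp G e}))}"
    by (simp add: odd_faces_def)
  also have "\<dots> = {f \<in> faces G. (e \<in> f) \<noteq> (opp G e \<in> f)}"
    using arev_neq[OF assms] by (auto simp: Int_insert_right)
  also have "\<dots> = sym_diff {face_of G e} {face_of G (opp G e)}"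
    using assms by (auto simp: face_eq_iff)
  finally show ?thesis .
qed

text \<open>\<open>rot G\<close> reaches every arc at a vertex and \<open>opp G\<close> crosses to a
  neighbour, so in a connected graph the two together reach every arc.\<close>

lemma connected_arc_induct:
  assumes con: "connected_multigraph G"
    and rot: "\<And>e. e \<in> arcs (dgr G) \<Longrightarrow> P e \<Longrightarrow> P (rot G e)"
    and opp: "\<And>e. e \<in> arcs (dgr G) \<Longrightarrow> P e \<Longrightarrow> P (opp G e)"
    and e0: "e0 \<in> arcs (dgr G)" "P e0" and e: "e \<in> arcs (dgr G)"
  shows "P e"
proof -
  have star: "P y" if "x \<in> arcs (dgr G)" "P x" "y \<in> arcs (dgr G)" "tail (dgr G) x = tail (dgr G) y" for x y
  proof -
    have "y \<in> orbit (rot G) x"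
      using orbit_cyclic_eq3[OF rot_cyclic[OF that(1)], of x] that by simp
    then have "y \<in> arcs (dgr G) \<and> P y"
      by induction (use that rot in auto)
    then show ?thesis by simp
  qed
  \<comment> \<open>By \<open>star\<close>, \<open>P\<close> is constant on the arcs at a vertex;
    \<open>Q\<close> makes it a property of vertices, to which \<open>connected_invariant\<close>
    applies.\<close>
  define Q where "Q v \<longleftrightarrow> (\<forall>x \<in> out_arcs (dgr G) v. P x)" for v
  have QI: "Q (tail (dgr G) x) \<longleftrightarrow> P x" if "x \<in> arcs (dgr G)" for x
    unfolding Q_def using that star[of x] by auto
  have "Q (tail (dgr G) e0) \<longleftrightarrow> Q (tail (dgr G) e)"
  proof (rule connected_invariant[OF con])
    fix a assume a: "a \<in> arcs (dgr G)"
    have "P a \<longleftrightarrow> P (opp G a)" using opp[of a] opp[of "opp G a"] a by auto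
    then show "Q (tail (dgr G) a) \<longleftrightarrow> Q (head (dgr G) a)"
      using QI[of a] QI[of "opp G a"] a by simp
  qed (use e0 e in auto)
  then show ?thesis using QI e0 e by simp
qed

text \<open>Connectedness of the dual graph: along a chain of adjacent faces the coboundaries of the
  crossed edges telescope to the two end faces.\<close>

lemma face_pair_odd_faces:
  assumes con: "connected_multigraph G" and e0: "e0 \<in> arcs (dgr G)" and e: "e \<in> arcs (dgr G)"
  shows "sym_diff {face_of G e0} {face_of G e} \<in> odd_faces ` Pow (edges G)"
proof -
  let ?I = "odd_faces ` Pow (edges G)"
  have add: "sym_diff A B \<in> ?I" if AB: "A \<in> ?I" "B \<in> ?I" for A B
  proof -
    obtain X Y where "X \<subseteq> edges G" "Y \<subseteq> edges G" "A = odd_faces X" "B = odd_faces Y"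
      using AB by auto
    then show ?thesis
      by (intro image_eqI[where x = "sym_diff X Y"]) (auto simp: odd_faces_sym_diff)
  qed
  have across: "sym_diff {face_of G e0} {face_of G (opp G a)} \<in> ?I"
    if a: "a \<in> arcs (dgr G)" and "sym_diff {face_of G e0} {face_of G a} \<in> ?I" for a
  proof -
    have "sym_diff {face_of G a} {face_of G (opp G a)} \<in> ?I"
      using a odd_faces_single_edge[OF a]
      by (intro image_eqI[where x = "{{a, opp G a}}"]) (auto simp: edges_def)
    from add[OF that(2) this] show ?thesis
      by (rule back_subst[where P = "\<lambda>A. A \<in> ?I"]) blast
  qed
  show ?thesis
  proof (rule connected_arc_induct[where P = "\<lambda>a. sym_diff {face_of G e0} {face_of G a} \<in> ?I"])
    fix a assume a: "a \<in> arcs (dgr G)" "sym_diff {face_of G e0} {face_of G a} \<in> ?I"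
    \<comment> \<open>The face to the left of \<open>a\<close> lies to the right of
      \<open>rot G a\<close>, so turning by one arc crosses a single edge.\<close>
    have "face_step G (opp G (rot G a)) = a"
      by (simp add: face_step_def permutes_inverses(2)[OF rot_permutes])
    then have "face_of G (opp G (rot G a)) = face_of G a"
      by (metis face_of_face_step)
    then show "sym_diff {face_of G e0} {face_of G (rot G a)} \<in> ?I"
      using across[of "opp G (rot G a)"] a by simp
  next
    show "sym_diff {face_of G e0} {face_of G e0} \<in> ?I"
      by (rule image_eqI[where x = "{}"]) (auto simp: odd_faces_def)
  qed (fact con e0 e across)+
qed

text \<open>The rank is at least the number of faces minus one: after forgetting one base face, sums
  of face pairs yield every set of the remaining faces.\<close>

lemma card_odd_faces_image:
  assumes con: "connected_multigraph G" and e0: "e0 \<in> arcs (dgr G)"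
  shows "2 ^ card (faces G) \<le> 2 * card (odd_faces ` Pow (edges G))"
proof -
  let ?I = "odd_faces ` Pow (edges G)" and ?f = "face_of G e0"
  have finI: "finite ?I" by (simp add: finite_edges)
  have surj: "\<exists>T \<in> ?I. T - {?f} = S" if S: "S \<subseteq> faces G - {?f}" for S
  proof -
    have "finite S" using S finite_faces by (meson finite_Diff finite_subset)
    then show ?thesis using S
    proof (induction S)
      case empty
      show ?case by (rule bexI[OF _ imageI[of "{}"]]) (auto simp: odd_faces_def)
    next
      case (insert g S)
      then obtain X where X: "X \<subseteq> edges G" "odd_faces X - {?f} = S" by auto
      from insert.prems obtain e where e: "e \<in> arcs (dgr G)" "g = face_of G e"
        by (auto simp: faces_def)
      obtain Y where Y: "Y \<subseteq> edges G" "odd_faces Y = sym_diff {?f} {g}"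
        using face_pair_odd_faces[OF con e0 e(1)] e(2) by auto
      \<comment> \<open>Away from the base face, adding the pair of \<open>?f\<close> and
        \<open>g\<close> changes the membership of \<open>g\<close> only.\<close>
      have "odd_faces (sym_diff X Y) - {?f} = insert g S"
        unfolding odd_faces_sym_diff Y(2) using X(2) insert.hyps insert.prems by auto
      then show ?case using X(1) Y(1) by (intro bexI[where x = "odd_faces (sym_diff X Y)"]) auto
    qed
  qed
  have "Pow (faces G - {?f}) \<subseteq> (\<lambda>T. T - {?f}) ` ?I"
  proof
    fix S assume "S \<in> Pow (faces G - {?f})"
    then obtain T where "T \<in> ?I" "T - {?f} = S" using surj[of S] by blast
    then show "S \<in> (\<lambda>T. T - {?f}) ` ?I" by blast
  qed
  then have "card (Pow (faces G - {?f})) \<le> card ?I"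
    using finI by (meson card_image_le card_mono finite_imageI order.trans)
  moreover have "card (faces G) = Suc (card (faces G - {?f}))"
    using e0 finite_faces by (metis card.remove faceI)
  ultimately show ?thesis
    using finite_faces by (simp add: card_Pow)
qed

text \<open>A vertex set with empty cut is constant along arcs, so by connectedness the kernel has
  at most two elements; rank-nullity gives the bound.\<close>

lemma card_cut_image:
  assumes con: "connected_multigraph G"
  shows "2 ^ card (vertices G) \<le> 2 * card (cut ` Pow (vertices G))"
proof -
  have "{S. S \<subseteq> vertices G \<and> cut S = {}} \<subseteq> {{}, vertices G}"
  proof
    fix S assume "S \<in> {S. S \<subseteq> vertices G \<and> cut S = {}}"
    then have S: "S \<subseteq> vertices G" "cut S = {}" by auto
    have "(u \<in> S) = (x \<in> S)" if ux: "u \<in> vertices G" "x \<in> vertices G" for u x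
    proof (rule connected_invariant[OF con])
      fix a assume "a \<in> arcs (dgr G)"
      then show "(tail (dgr G) a \<in> S) = (head (dgr G) a \<in> S)"
        using edge_in_cut[of a S] S(2) by simp
    qed (use ux in auto)
    then show "S \<in> {{}, vertices G}" using S(1) by blast
  qed
  then have "card {S. S \<subseteq> vertices G \<and> cut S = {}} \<le> card {{}, vertices G}"
    by (rule card_mono[rotated]) simp
  also have "\<dots> \<le> 2" by (simp add: card_insert_if)
  finally have "card {S. S \<subseteq> vertices G \<and> cut S = {}} \<le> 2" .
  then show ?thesis
    unfolding card_Pow_sym_diff_hom[OF finite_verts cut_sym_diff] by (rule mult_right_mono) simp
qed

text \<open>
  The cellular cohomology of the sphere over the field of two elements: the Euler characteristic
  leaves no room for a 1-cocycle that is not a coboundary, and if all faces are even, then the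
  set of all edges is a 1-cocycle.
\<close>

lemma spherical_even_faces_bipartite:
  assumes sph: "spherical_embedding G" and even: "\<And>f. f \<in> faces G \<Longrightarrow> even (card f)"
  obtains S where "S \<subseteq> vertices G"
    "\<And>e. e \<in> arcs (dgr G) \<Longrightarrow> (tail (dgr G) e \<in> S) \<noteq> (head (dgr G) e \<in> S)"
proof (cases "arcs (dgr G) = {}")
  case True
  then show ?thesis using that[of "{}"] by simp
next
  case False
  then obtain e0 where e0: "e0 \<in> arcs (dgr G)" by auto
  have con: "connected_multigraph G"
    and euler: "int (card (vertices G)) - int (card (edges G)) + int (card (faces G)) = 2"
    using sph by (auto simp: spherical_embedding_def)
  \<comment> \<open>Cocycles \<open>?K\<close> and coboundaries \<open>?C\<close>. The two rank
    bounds lose a factor 2 each, which is exactly the 2 in Euler's formula; hence \<open>?K\<close>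
    is no larger than \<open>?C\<close>.\<close>
  let ?K = "{X. X \<subseteq> edges G \<and> odd_faces X = {}}" and ?C = "cut ` Pow (vertices G)"
  let ?F = "2 ^ card (faces G) :: nat"
  have "card ?K * ?F \<le> card ?K * (2 * card (odd_faces ` Pow (edges G)))"
    using card_odd_faces_image[OF con e0] by (rule mult_left_mono) simp
  also have "\<dots> = 2 * 2 ^ card (edges G)"
    using card_Pow_sym_diff_hom[OF finite_edges odd_faces_sym_diff] by simp
  finally have "2 * (card ?K * ?F) \<le> 2 ^ (card (edges G) + 2)" by (simp add: mult.commute)
  also have "card (edges G) + 2 = card (vertices G) + card (faces G)" using euler by linarith
  also have "2 ^ (card (vertices G) + card (faces G)) \<le> 2 * (card ?C * ?F)"
    using mult_right_mono[OF card_cut_image[OF con], of ?F] by (simp add: power_add)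
  finally have "card ?K \<le> card ?C" by simp
  moreover have "?C \<subseteq> ?K" using cut_subset odd_faces_cut by auto
  moreover have "finite ?K" using finite_edges by simp
  ultimately have "?C = ?K" by (intro card_seteq) auto
  moreover have "edges G \<in> ?K"
  proof -
    have "{e \<in> f. {e, opp G e} \<in> edges G} = f" if "f \<in> faces G" for f
      using faces_subset[OF that] by (auto simp: edges_def)
    then show ?thesis using even by (auto simp: odd_faces_def)
  qed
  ultimately have "edges G \<in> ?C" by simp
  \<comment> \<open>A vertex set whose cut consists of all edges is a colour class.\<close>
  then obtain S where S: "S \<subseteq> vertices G" "edges G = cut S" by auto
  have "(tail (dgr G) e \<in> S) \<noteq> (head (dgr G) e \<in> S)" if e: "e \<in> arcs (dgr G)" for e
  proof -
    have "{e, opp G e} \<in> cut S" using e S(2) by (auto simp: edges_def)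
    then show ?thesis using edge_in_cut[OF e] by simp
  qed
  with S(1) that show ?thesis by blast
qed

section \<open>Transverse walks in the radial graph\<close>

abbreviation (input) R where "R \<equiv> radial_graph G"

lemma radial_simps [simp]:
  "vertices R = Inl ` vertices G \<union> Inr ` faces G"
  "arcs (dgr R) = arcs (dgr G) \<times> UNIV"
  "tail (dgr R) (e, False) = Inl (tail (dgr G) e)"
  "tail (dgr R) (e, True) = Inr (face_of G e)"
  "head (dgr R) (e, False) = Inr (face_of G e)"
  "head (dgr R) (e, True) = Inl (tail (dgr G) e)"
  "rot R (e, False) = (rot G e, False)"
  "rot R (e, True) = (face_step G e, True)"
  by (simp_all add: radial_graph_def)

lemma wf_digraph_radial: "wf_digraph (dgr R)"
  by unfold_locales (auto simp: radial_graph_def)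

lemma radial_opp [simp]: "e \<in> arcs (dgr G) \<Longrightarrow> opp R (e, b) = (e, \<not> b)"
  by (simp add: radial_graph_def)

lemma degree_radial_vertex [simp]: "degree R (Inl v) = degree G v"
proof -
  have "out_arcs (dgr R) (Inl v) = (\<lambda>e. (e, False)) ` out_arcs (dgr G) v"
    by (auto simp: radial_graph_def image_iff split: if_splits)
  then show ?thesis by (simp add: out_degree_def card_image inj_on_def)
qed

lemma degree_radial_face:
  assumes "f \<in> faces G"
  shows "degree R (Inr f) = card f"
proof -
  have "out_arcs (dgr R) (Inr f) = (\<lambda>e. (e, True)) ` f"
    using faces_subset[OF assms] face_eq_iff[OF assms]
    by (auto simp: radial_graph_def image_iff split: if_splits)
  then show ?thesis by (simp add: out_degree_def card_image inj_on_def)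
qed

text \<open>At a vertex of degree 4 only the half-edge two places further in the rotation is neither
  equal nor adjacent to the incoming one. Around a face the rotation is
  \<open>face_step G\<close>.\<close>

lemma passes_transversely_face:
  assumes e: "e \<in> arcs (dgr G)" and 4: "card (face_of G e) = 4" and y: "y \<in> arcs (dgr R)"
  shows "passes_transversely R (e, False) y \<longleftrightarrow> y = (face_step G (face_step G e), True)"
proof -
  note c = cyclic_on_card_4[OF face_cyclic 4 face_of_self]
  obtain e' b where y': "y = (e', b)" "e' \<in> arcs (dgr G)" using y by auto
  show ?thesis
  proof (cases "b \<and> face_of G e' = face_of G e")
    case True
    then have "e' \<in> face_of G e" using face_of_self[of e'] by simp
    then consider "e' = e" | "e' = face_step G e" | "e' = face_step G (face_step G e)"
      | "e' = face_step G (face_step G (face_step G e))"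
      using c(1) by blast
    then show ?thesis
      using True e y' 4 c(2-) by cases (auto simp: passes_transversely_def degree_radial_face)
  next
    case False
    then show ?thesis
      using e y' by (cases b) (auto simp: passes_transversely_def)
  qed
qed

lemma passes_transversely_vertex:
  assumes e: "e \<in> arcs (dgr G)" and 4: "degree G (tail (dgr G) e) = 4" and y: "y \<in> arcs (dgr R)"
  shows "passes_transversely R (e, True) y \<longleftrightarrow> y = (rot G (rot G e), False)"
proof -
  have e_out: "e \<in> out_arcs (dgr G) (tail (dgr G) e)" using e by simp
  note c = cyclic_on_card_4[OF rot_cyclic[OF e] 4[unfolded out_degree_def] e_out]
  obtain e' b where y': "y = (e', b)" "e' \<in> arcs (dgr G)" using y by auto
  show ?thesis
  proof (cases "\<not> b \<and> tail (dgr G) e' = tail (dgr G) e")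
    case True
    then have "e' \<in> out_arcs (dgr G) (tail (dgr G) e)" using y' by simp
    then consider "e' = e" | "e' = rot G e" | "e' = rot G (rot G e)" | "e' = rot G (rot G (rot G e))"
      using c(1) by blast
    then show ?thesis
      using True e y' 4 c(2-) by cases (auto simp: passes_transversely_def)
  next
    case False
    then show ?thesis
      using e y' by (cases b) (auto simp: passes_transversely_def)
  qed
qed

text \<open>\<open>tail (dgr G) (fst x)\<close> is the end of the radial arc \<open>x\<close> that
  is a vertex of \<open>G\<close>. Through a face this end moves two steps along the boundary and
  changes colour twice; through a vertex of \<open>G\<close> it stays put.\<close>

lemma passes_transversely_same_side:
  assumes quad: "\<And>f. f \<in> faces G \<Longrightarrow> card f = 4"
    and S: "\<And>e. e \<in> arcs (dgr G) \<Longrightarrow> (tail (dgr G) e \<in> S) \<noteq> (head (dgr G) e \<in> S)"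
    and x: "x \<in> arcs (dgr R)" and y: "y \<in> arcs (dgr R)" and pass: "passes_transversely R x y"
  shows "tail (dgr G) (fst x) \<in> S \<longleftrightarrow> tail (dgr G) (fst y) \<in> S"
proof -
  obtain e b where x': "x = (e, b)" and e: "e \<in> arcs (dgr G)" using x by auto
  show ?thesis
  proof (cases b)
    case False
    then have "y = (face_step G (face_step G e), True)"
      using passes_transversely_face[OF e quad y] pass x' e by simp
    then show ?thesis using x' e S[of e] S[of "face_step G e"] by simp
  next
    case True
    \<comment> \<open>The head of \<open>x\<close> is a vertex of \<open>G\<close>, and
      \<open>y\<close> has to leave that same vertex.\<close>
    obtain e' b' where "y = (e', b')" by fastforce
    then show ?thesis using pass True x' by (cases b') (auto simp: passes_transversely_def)
  qed
qed

section \<open>Colour classes along transverse paths and in the extraction\<close>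

lemma transverse_path_same_side:
  assumes quad: "\<And>f. f \<in> faces G \<Longrightarrow> card f = 4"
    and S: "\<And>e. e \<in> arcs (dgr G) \<Longrightarrow> (tail (dgr G) e \<in> S) \<noteq> (head (dgr G) e \<in> S)"
    and path: "transverse_path R u p v" and "p \<noteq> []"
  shows "tail (dgr G) (fst (hd p)) \<in> S \<longleftrightarrow> tail (dgr G) (fst (last p)) \<in> S"
proof -
  have arcs: "set p \<subseteq> arcs (dgr R)"
    using path by (simp add: transverse_path_def pre_digraph.awalk_def)
  have "i < length p \<Longrightarrow> tail (dgr G) (fst (p ! 0)) \<in> S \<longleftrightarrow> tail (dgr G) (fst (p ! i)) \<in> S" for i
  proof (induction i)
    case (Suc i)
    have "p ! i \<in> arcs (dgr R)" "p ! Suc i \<in> arcs (dgr R)"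
      using Suc.prems arcs nth_mem[of i p] nth_mem[of "Suc i" p] by (auto simp del: radial_simps)
    moreover have "passes_transversely R (p ! i) (p ! Suc i)"
      using path Suc.prems by (simp add: transverse_path_def)
    ultimately show ?case
      using passes_transversely_same_side[OF quad S] Suc by simp
  qed simp
  then show ?thesis using \<open>p \<noteq> []\<close> by (simp add: hd_conv_nth last_conv_nth)
qed

text \<open>Each arc of the extraction joins vertices of one colour, so the colour is constant on a
  connected extraction.\<close>

lemma extraction_connected_same_side:
  assumes quad: "\<And>f. f \<in> faces G \<Longrightarrow> card f = 4"
    and S: "\<And>e. e \<in> arcs (dgr G) \<Longrightarrow> (tail (dgr G) e \<in> S) \<noteq> (head (dgr G) e \<in> S)"
    and con: "connected_multigraph (extraction R)"
    and u: "u \<in> vertices G" "degree G u = 3" and v: "v \<in> vertices G" "degree G v = 3"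
  shows "u \<in> S \<longleftrightarrow> v \<in> S"
proof -
  let ?X = "extraction R"
  have "(Inl u \<in> (Inl ` S :: ('v + 'e set) set)) = (Inl v \<in> (Inl ` S :: ('v + 'e set) set))"
  proof (rule connected_invariant[OF con, where P = "\<lambda>x. x \<in> Inl ` S"])
    fix p assume "p \<in> arcs (dgr ?X)"
    then obtain a b where p: "complete_transverse_path R a p b"
      by (auto simp: extraction_def Let_def)
    then have path: "transverse_path R a p b" and ne: "p \<noteq> []" and deg: "degree R a = 3" "degree R b = 3"
      by (auto simp: complete_transverse_path_def)
    then have walk: "a \<in> vertices R" "set p \<subseteq> arcs (dgr R)" "pre_digraph.cas (dgr R) a p b"
      by (auto simp: transverse_path_def pre_digraph.awalk_def)
    have a: "tail (dgr R) (hd p) = a"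
      using walk(3) ne by (cases p) (auto simp: pre_digraph.cas.simps)
    have b: "head (dgr R) (last p) = b"
      using walk(3) ne by (induction p arbitrary: a) (auto simp: pre_digraph.cas.simps split: if_splits)
    obtain e c where e: "hd p = (e, c)" "e \<in> arcs (dgr G)"
      using walk(2) hd_in_set[OF ne] by (cases "hd p") auto
    obtain e' c' where e': "last p = (e', c')" "e' \<in> arcs (dgr G)"
      using walk(2) last_in_set[OF ne] by (cases "last p") auto
    \<comment> \<open>Face-vertices have degree 4, so a complete path starts and ends at vertices of
      \<open>G\<close>: its first arc leaves one and its last arc enters one.\<close>
    have "\<not> c" using a deg(1) e quad by (auto simp: degree_radial_face)
    moreover have "c'" using b deg(2) e' quad by (cases c') (auto simp: degree_radial_face)
    ultimately have "tail (dgr R) (hd p) \<in> Inl ` S \<longleftrightarrow> head (dgr R) (last p) \<in> Inl ` S"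
      using transverse_path_same_side[OF quad S path ne] e e' by (auto simp: inj_image_mem_iff)
    then show "tail (dgr ?X) p \<in> Inl ` S \<longleftrightarrow> head (dgr ?X) p \<in> Inl ` S"
      by (simp add: extraction_def Let_def)
  qed (use u v in \<open>auto simp: extraction_def Let_def\<close>)
  then show ?thesis by auto
qed

section \<open>Closing up a transverse walk\<close>

definition transverse_step :: "'e \<times> bool \<Rightarrow> 'e \<times> bool" where
  "transverse_step = (\<lambda>(e, b). if b then (rot G (rot G e), False)
                               else (face_step G (face_step G e), True))"

text \<open>Injectivity makes a finite forward orbit return to its starting arc itself, instead of
  merely running into a cycle.\<close>

lemma inj_transverse_step: "inj transverse_step"
proof (rule injI)
  fix x y assume "transverse_step x = transverse_step y"
  then show "x = y"
    by (cases x; cases y)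
      (auto simp: transverse_step_def inj_eq[OF permutes_inj[OF rot_permutes]]
        inj_eq[OF permutes_inj[OF face_step_permutes]] split: if_splits)
qed

text \<open>The radial arcs at vertices outside \<open>S\<close> form a finite set closed under
  \<open>transverse_step\<close>, and each step there is transverse; one period of an orbit is the
  required closed walk.\<close>

lemma transversal_if_degree_4_side:
  assumes quad: "\<And>f. f \<in> faces G \<Longrightarrow> card f = 4"
    and S: "\<And>e. e \<in> arcs (dgr G) \<Longrightarrow> (tail (dgr G) e \<in> S) \<noteq> (head (dgr G) e \<in> S)"
    and deg4: "\<And>v. v \<in> vertices G \<Longrightarrow> v \<notin> S \<Longrightarrow> degree G v = 4"
    and e0: "e0 \<in> arcs (dgr G)" "tail (dgr G) e0 \<notin> S"
  shows "\<exists>p. transversal R p"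
proof -
  define A where "A = {x \<in> arcs (dgr R). tail (dgr G) (fst x) \<notin> S}"
  have step: "transverse_step x \<in> A" "passes_transversely R x (transverse_step x)"
    if x_in: "x \<in> A" for x
  proof -
    obtain e b where x: "x = (e, b)" "e \<in> arcs (dgr G)" "tail (dgr G) e \<notin> S"
      using x_in by (cases x) (auto simp: A_def)
    show "transverse_step x \<in> A"
      using x S[of e] S[of "face_step G e"] by (auto simp: A_def transverse_step_def)
    show "passes_transversely R x (transverse_step x)"
      using x passes_transversely_face[OF x(2) quad] passes_transversely_vertex[OF x(2) deg4]
      by (cases b) (auto simp: transverse_step_def)
  qed
  define w where "w i = (transverse_step ^^ i) (e0, False)" for i
  have w0: "w 0 = (e0, False)" and wSuc: "w (Suc i) = transverse_step (w i)" for i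
    by (simp_all add: w_def)
  have wA: "w i \<in> A" for i
    by (induction i) (use e0 step in \<open>auto simp: w0 wSuc A_def\<close>)
  have "finite A" by (simp add: A_def)
  have "{y. \<exists>n. y = (transverse_step ^^ n) (e0, False)} \<subseteq> A" using wA by (auto simp: w_def)
  then have "finite {y. \<exists>n. y = (transverse_step ^^ n) (e0, False)}"
    using \<open>finite A\<close> by (rule finite_subset)
  then obtain n where n: "n > 0" "w n = w 0"
    unfolding w_def using funpow_inj_finite[OF inj_transverse_step] by (metis funpow_0)
  define p where "p = map w [0..<n]"
  have pass: "passes_transversely R (w i) (w (Suc i))" for i
    using step(2)[OF wA] by (simp add: wSuc)
  have arc: "w i \<in> arcs (dgr R)" for i using wA by (simp add: A_def)
  \<comment> \<open>The start \<open>i\<close> is general because the induction removes the first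
    arc.\<close>
  have cas: "pre_digraph.cas (dgr R) (tail (dgr R) (w i)) (map w [i..<i + k]) (tail (dgr R) (w (i + k)))" for i k
  proof (induction k arbitrary: i)
    case (Suc k)
    have "[i..<i + Suc k] = i # [Suc i..<Suc i + k]" by (simp add: upt_conv_Cons)
    then show ?case
      using Suc.IH[of "Suc i"] pass[of i]
      by (simp add: pre_digraph.cas.simps passes_transversely_def del: upt.simps)
  qed (simp add: pre_digraph.cas.simps)
  have tail4: "degree R (tail (dgr R) (w i)) = 4" for i
  proof -
    obtain e b where "w i = (e, b)" "e \<in> arcs (dgr G)" "tail (dgr G) e \<notin> S"
      using wA[of i] by (cases "w i") (auto simp: A_def)
    then show ?thesis by (cases b) (auto simp: degree_radial_face quad deg4)
  qed
  have "Inl (tail (dgr G) e0) \<in> vertices R" using e0 by simp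
  then have walk: "pre_digraph.awalk (dgr R) (tail (dgr R) (w 0)) p (tail (dgr R) (w 0))"
    using cas[of 0 n] arc n by (auto simp: pre_digraph.awalk_def p_def w0 simp del: radial_simps(1,2))
  have "degree R x = 4" if "x \<in> set (pre_digraph.awalk_verts (dgr R) (tail (dgr R) (w 0)) p)" for x
  proof -
    \<comment> \<open>The head of \<open>w i\<close> is the tail of \<open>w (Suc i)\<close>, so the
      walk visits only tails of the orbit.\<close>
    have "x \<in> {tail (dgr R) (w 0)} \<union> set (map (tail (dgr R)) p) \<union> set (map (head (dgr R)) p)"
      using that walk wf_digraph.set_awalk_verts[OF wf_digraph_radial] by blast
    then obtain i where "x = tail (dgr R) (w i)"
      using pass by (auto simp: p_def passes_transversely_def)
    then show ?thesis using tail4 by simp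
  qed
  moreover have "passes_transversely R (p ! i) (p ! (Suc i mod length p))" if "i < length p" for i
    \<comment> \<open>For the last index the successor wraps round to \<open>w 0\<close>, which
      equals \<open>w n\<close>.\<close>
    using that pass[of i] n by (cases "Suc i = n") (auto simp: p_def)
  ultimately have "transversal R p"
    using walk n(1) unfolding transversal_def p_def by auto
  then show ?thesis ..
qed

text \<open>
  Every edge has exactly one end outside \<open>S\<close>, so if the vertices there all have degree 4, then
  they account for all edges; Euler's formula turns this into \<open>n = 2 b + 2\<close>, where \<open>b\<close> is
  their number.
\<close>

lemma card_vertices_if_degree_4_side:
  assumes sph: "spherical_embedding G" and quad: "\<And>f. f \<in> faces G \<Longrightarrow> card f = 4"
    and S: "\<And>e. e \<in> arcs (dgr G) \<Longrightarrow> (tail (dgr G) e \<in> S) \<noteq> (head (dgr G) e \<in> S)"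
    and deg4: "\<And>v. v \<in> vertices G \<Longrightarrow> v \<notin> S \<Longrightarrow> degree G v = 4"
  shows "card (vertices G) = 2 * card (vertices G - S) + 2"
    "card (arcs (dgr G)) = 8 * card (vertices G - S)"
proof -
  let ?A = "arcs (dgr G)"
  let ?out = "{e \<in> ?A. tail (dgr G) e \<in> vertices G - S}"
  let ?in = "{e \<in> ?A. tail (dgr G) e \<in> S}"
  \<comment> \<open>Reversal exchanges the arcs leaving the two colour classes, so half of all arcs
    start outside \<open>S\<close>.\<close>
  have "bij_betw (opp G) ?out ?in"
    by (rule bij_betwI[where g = "opp G"]) (use S in auto)
  then have "card ?out = card ?in" by (rule bij_betw_same_card)
  moreover have "card ?A = card ?out + card ?in"
  proof -
    have "?A = ?out \<union> ?in" by auto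
    then show ?thesis by (metis (no_types, lifting) card_Un_disjoint finite_arcs finite_Un disjoint_iff mem_Collect_eq DiffD2)
  qed
  moreover have "card ?out = 4 * card (vertices G - S)"
    using card_arcs_degrees[of "vertices G - S"] deg4 by simp
  ultimately show A: "card ?A = 8 * card (vertices G - S)" by simp
  have "card ?A = 4 * card (faces G)" using card_arcs_faces quad by simp
  moreover have "int (card (vertices G)) - int (card (edges G)) + int (card (faces G)) = 2"
    using sph by (simp add: spherical_embedding_def)
  \<comment> \<open>With \<open>b\<close> vertices outside \<open>S\<close> there are
    \<open>4 b\<close> edges and \<open>2 b\<close> faces.\<close>
  ultimately show "card (vertices G) = 2 * card (vertices G - S) + 2"
    using A card_arcs_edges by linarith
qed

section \<open>A colour class without vertices of degree 3\<close>

lemma cubic_vertices_one_side: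
  assumes cq: "cubic_quadrangulation G" and con: "connected_multigraph (extraction R)"
  obtains S where "\<And>e. e \<in> arcs (dgr G) \<Longrightarrow> (tail (dgr G) e \<in> S) \<noteq> (head (dgr G) e \<in> S)"
    "\<And>v. v \<in> vertices G \<Longrightarrow> v \<notin> S \<Longrightarrow> degree G v = 4"
proof -
  have sph: "spherical_embedding G" and deg: "\<And>v. v \<in> vertices G \<Longrightarrow> degree G v = 3 \<or> degree G v = 4"
    and quad: "\<And>f. f \<in> faces G \<Longrightarrow> card f = 4"
    using cq by (auto simp: cubic_quadrangulation_def)
  obtain S where S: "\<And>e. e \<in> arcs (dgr G) \<Longrightarrow> (tail (dgr G) e \<in> S) \<noteq> (head (dgr G) e \<in> S)"
    by (rule spherical_even_faces_bipartite[OF sph]) (use quad in auto)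
  note same = extraction_connected_same_side[OF quad S con]
  show ?thesis
  proof (cases "\<exists>v \<in> vertices G. degree G v = 3 \<and> v \<notin> S")
    case True
    \<comment> \<open>One cubic vertex outside \<open>S\<close> forces all of them outside, so the
      complement of \<open>S\<close> serves as the colour class.\<close>
    then have "\<And>v. v \<in> vertices G \<Longrightarrow> v \<notin> - S \<Longrightarrow> degree G v = 4"
      using deg same by blast
    then show ?thesis using that[of "- S"] S by simp
  next
    case False
    then show ?thesis using that[of S] S deg by blast
  qed
qed

end

theorem theorem5p4:
  fixes G :: "('v, 'e) embedded_multigraph"
  assumes "cubic_quadrangulation G"
  shows "(odd (card (vertices G)) \<longrightarrow> \<not> connected_multigraph (extraction (radial_graph G))) \<and>
         (connected_multigraph (extraction (radial_graph G)) \<longrightarrow>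
            (\<exists>p. transversal (radial_graph G) p))"
proof -
  interpret embedding G
    using assms by unfold_locales (simp add: cubic_quadrangulation_def spherical_embedding_def)
  have sph: "spherical_embedding G" and quad: "\<And>f. f \<in> faces G \<Longrightarrow> card f = 4"
    and deg: "\<And>v. v \<in> vertices G \<Longrightarrow> degree G v = 3 \<or> degree G v = 4"
    using assms by (auto simp: cubic_quadrangulation_def)
  \<comment> \<open>One implication covers both claims; the first is the contrapositive of its
    parity part.\<close>
  have "even (card (vertices G)) \<and> (\<exists>p. transversal (radial_graph G) p)"
    if "connected_multigraph (extraction (radial_graph G))"
  proof -
    obtain S where S: "\<And>e. e \<in> arcs (dgr G) \<Longrightarrow> (tail (dgr G) e \<in> S) \<noteq> (head (dgr G) e \<in> S)"
      and deg4: "\<And>v. v \<in> vertices G \<Longrightarrow> v \<notin> S \<Longrightarrow> degree G v = 4"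
      using cubic_vertices_one_side[OF assms \<open>connected_multigraph _\<close>] by blast
    note card = card_vertices_if_degree_4_side[OF sph quad S deg4]
    \<comment> \<open>The count gives at least two vertices, a vertex has an arc by its degree, and
      this arc or its reverse starts outside \<open>S\<close>.\<close>
    from card(1) have "vertices G \<noteq> {}" by auto
    then obtain v where "v \<in> vertices G" by auto
    then have "out_arcs (dgr G) v \<noteq> {}" using deg[of v] by (auto simp: out_degree_def)
    then obtain e where e: "e \<in> arcs (dgr G)" by auto
    obtain e0 where "e0 \<in> arcs (dgr G)" "tail (dgr G) e0 \<notin> S"
    proof (cases "tail (dgr G) e \<in> S")
      case True
      then show ?thesis using e S[OF e] that[of "opp G e"] by simp
    next
      case False
      then show ?thesis using e by (rule that[rotated])
    qed
    then show ?thesis using transversal_if_degree_4_side[OF quad S deg4] card(1) by simp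
  qed
  then show ?thesis by auto
qed

end
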